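(* For the Kalman canonical form of a quantum linear system, consider the "h" subsystem $$\begin{bmatrix} \dot{\boldsymbol q}_h \\ \dot{\boldsymbol p}_h \end{bmatrix}=\begin{bmatrix} A_h^{11} & A_h^{12} \\ 0 & A_h^{22} \end{bmatrix}\begin{bmatrix} \boldsymbol q_h \\ \boldsymbol p_h \end{bmatrix}+\begin{bmatrix} B_h \\ 0 \end{bmatrix}\boldsymbol u,\qquad \boldsymbol y=\begin{bmatrix} 0 & C_h \end{bmatrix}\begin{bmatrix} \boldsymbol q_h \\ \boldsymbol p_h \end{bmatrix}+\boldsymbol u.$$ Then: 1) the set of poles of this subsystem (eigenvalues of its system matrix) is $\sigma(A_h^{11})\cup\sigma(-A_h^{11})$; 2) if $\lambda$ is a pole of this subsystem, then so are $-\lambda,\lambda^*,-\lambda^*$.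
   Context: Notation: $\sigma(\cdot)$ is the set of eigenvalues; $\lambda^*$ is the complex conjugate; $X^{\#}$ is the entrywise complex conjugate, $X^\dag=(X^{\#})^\top$; $J_k=\mathrm{diag}(I_k,-I_k)$; $X^\flat=J_rX^\dag J_k$ for $X\in\mathbb C^{2k\times2r}$; $\Delta(U,V)=\begin{bmatrix} U & V \\ U^{\#} & V^{\#} \end{bmatrix}$; $V_k=\frac1{\sqrt2}\begin{bmatrix} I_k & I_k \\ -\imath I_k & \imath I_k \end{bmatrix}$. Quantum linear system with $n$ oscillators and $m$ fields: $\mathcal C=\Delta(C_-,C_+)$, $\mathcal B=-\mathcal C^\flat$, $\mathcal A=-\imath J_n\Omega-\frac12\mathcal C^\flat\mathcal C$, with $C_\pm\in\mathbb C^{m\times n}$ and $\Omega=\Delta(\Omega_-,\Omega_+)\in\mathbb C^{2n\times2n}$ Hermitian. Kalman canonical form ($n=n_1+n_2+n_3$): there are $Z_j\in\mathbb C^{n\times n_j}$ ($j=1,2,3$) such that $$T=\begin{bmatrix} Z_3 & 0 & Z_1 & 0 & Z_2 & 0 \\ 0 & Z_3^{\#} & 0 & Z_1^{\#} & 0 & Z_2^{\#} \end{bmatrix}$$ is unitary with $T^\dag J_nT=\mathrm{diag}(J_{n_3},J_{n_1},J_{n_2})$; and, with $n_3=n_a+n_b$ and $$\Pi=\begin{bmatrix} I_{n_a} & 0 & 0 & 0 \\ 0 & 0 & 0 & -I_{n_b} \\ 0 & 0 & I_{n_a} & 0 \\ 0 & I_{n_b} & 0 & 0 \end{bmatrix},\qquad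 \tilde V_n=\mathrm{diag}(\Pi V_{n_3},V_{n_1},V_{n_2}),\qquad \hat T=T\tilde V_n^\dag,$$ the matrices $\bar A=\hat T^\dag\mathcal A\hat T$, $\bar B=\hat T^\dag\mathcal BV_m^\dag$, $\bar C=V_m\mathcal C\hat T$ are real and, in the partition $\boldsymbol q_h,\boldsymbol p_h,\boldsymbol x_{co},\boldsymbol x_{\bar c\bar o}$ with lengths $n_3,n_3,2n_1,2n_2$, $$\bar A=\begin{bmatrix} A_h^{11} & A_h^{12} & A_{12} & A_{13} \\ 0 & A_h^{22} & 0 & 0 \\ 0 & A_{21} & A_{co} & 0 \\ 0 & A_{31} & 0 & A_{\bar c\bar o} \end{bmatrix},\quad \bar B=\begin{bmatrix} B_h \\ 0 \\ B_{co} \\ 0 \end{bmatrix},\quad \bar C=\begin{bmatrix} 0 & C_h & C_{co} & 0 \end{bmatrix},$$ with the controllable subspace of $(\bar A,\bar B)$ the span of the $\boldsymbol q_h,\boldsymbol x_{co}$ coordinates and the unobservable subspace of $(\bar A,\bar C)$ the span of the $\boldsymbol q_h,\boldsymbol x_{\bar c\bar o}$ coordinates. *)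

theory Defs
  imports
    "Jordan_Normal_Form.Spectral_Radius"
    "Jordan_Normal_Form.Schur_Decomposition"
    "Jordan_Normal_Form.VS_Connect"
begin

text \<open>Horizontal counterpart of \<open>(@\<^sub>r)\<close>; it binds more tightly, so a block matrix is written
  row by row as \<open>A @\<^sub>c B @\<^sub>r C @\<^sub>c D\<close>.\<close>

definition append_cols :: "'a :: zero mat \<Rightarrow> 'a mat \<Rightarrow> 'a mat" (infixr \<open>@\<^sub>c\<close> 66) where
  "A @\<^sub>c B = four_block_mat A B (0\<^sub>m 0 (dim_col A)) (0\<^sub>m 0 (dim_col B))"

text \<open>\<open>X\<^sup>#\<close> is \<open>mat_cnj X\<close> and \<open>X\<^sup>\<dagger>\<close> is \<open>mat_adjoint X\<close>.\<close>

definition mat_cnj :: "complex mat \<Rightarrow> complex mat" where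
  "mat_cnj X = map_mat cnj X"

definition unitary_mat :: "complex mat \<Rightarrow> bool" where
  "unitary_mat U \<longleftrightarrow> square_mat U \<and> mat_adjoint U * U = 1\<^sub>m (dim_row U)
     \<and> U * mat_adjoint U = 1\<^sub>m (dim_row U)"

definition real_mat :: "complex mat \<Rightarrow> bool" where
  "real_mat X \<longleftrightarrow> elements_mat X \<subseteq> \<real>"

definition J_mat :: "nat \<Rightarrow> complex mat" where
  "J_mat k = diag_block_mat [1\<^sub>m k, - 1\<^sub>m k]"

text \<open>\<open>X\<^sup>\<flat> = J\<^sub>r X\<^sup>\<dagger> J\<^sub>k\<close> for \<open>X\<close> of dimension \<open>2k \<times> 2r\<close>; meaningful only for even dimensions.\<close>

definition mat_flat :: "complex mat \<Rightarrow> complex mat" where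
  "mat_flat X = J_mat (dim_col X div 2) * mat_adjoint X * J_mat (dim_row X div 2)"

text \<open>The source prints the doubled-up matrix \<open>\<Delta>(U,V)\<close> with second block row \<open>(U\<^sup>#, V\<^sup>#)\<close>
  (\<open>Delta_printed\<close>). The usual doubled-up matrix, for which quadrature coordinates turn
  \<open>\<Delta>(U,V)\<close> into a real matrix, has second block row \<open>(V\<^sup>#, U\<^sup>#)\<close> (\<open>Delta\<close>).
  Both are provided.\<close>

definition Delta :: "complex mat \<Rightarrow> complex mat \<Rightarrow> complex mat" where
  "Delta U V = four_block_mat U V (mat_cnj V) (mat_cnj U)"

definition Delta_printed :: "complex mat \<Rightarrow> complex mat \<Rightarrow> complex mat" where
  "Delta_printed U V = four_block_mat U V (mat_cnj U) (mat_cnj V)"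

definition V_mat :: "nat \<Rightarrow> complex mat" where
  "V_mat k = complex_of_real (1 / sqrt 2) \<cdot>\<^sub>m
     four_block_mat (1\<^sub>m k) (1\<^sub>m k) ((- \<i>) \<cdot>\<^sub>m 1\<^sub>m k) (\<i> \<cdot>\<^sub>m 1\<^sub>m k)"

definition Pi_mat :: "nat \<Rightarrow> nat \<Rightarrow> complex mat" where
  "Pi_mat na nb =
     (1\<^sub>m na    @\<^sub>c 0\<^sub>m na nb @\<^sub>c 0\<^sub>m na na @\<^sub>c 0\<^sub>m na nb @\<^sub>r
      0\<^sub>m nb na @\<^sub>c 0\<^sub>m nb nb @\<^sub>c 0\<^sub>m nb na @\<^sub>c - 1\<^sub>m nb  @\<^sub>r
      0\<^sub>m na na @\<^sub>c 0\<^sub>m na nb @\<^sub>c 1\<^sub>m na    @\<^sub>c 0\<^sub>m na nb @\<^sub>r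
      0\<^sub>m nb na @\<^sub>c 1\<^sub>m nb    @\<^sub>c 0\<^sub>m nb na @\<^sub>c 0\<^sub>m nb nb)"

text \<open>System matrices of the quantum linear system with coupling matrix \<open>C\<close> and Hamiltonian
  matrix \<open>\<Omega>\<close>; the output matrix is \<open>C\<close> itself and the feedthrough matrix is the identity.\<close>

definition qls_A :: "nat \<Rightarrow> complex mat \<Rightarrow> complex mat \<Rightarrow> complex mat" where
  "qls_A n \<Omega> C = (- \<i>) \<cdot>\<^sub>m (J_mat n * \<Omega>) - (1/2) \<cdot>\<^sub>m (mat_flat C * C)"

definition qls_B :: "complex mat \<Rightarrow> complex mat" where
  "qls_B C = - mat_flat C"

definition T_mat :: "complex mat \<Rightarrow> complex mat \<Rightarrow> complex mat \<Rightarrow> complex mat" where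
  "T_mat Z1 Z2 Z3 =
     (let n = dim_row Z1; n1 = dim_col Z1; n2 = dim_col Z2; n3 = dim_col Z3 in
      Z3 @\<^sub>c 0\<^sub>m n n3 @\<^sub>c Z1 @\<^sub>c 0\<^sub>m n n1 @\<^sub>c Z2 @\<^sub>c 0\<^sub>m n n2 @\<^sub>r
      0\<^sub>m n n3 @\<^sub>c mat_cnj Z3 @\<^sub>c 0\<^sub>m n n1 @\<^sub>c mat_cnj Z1 @\<^sub>c 0\<^sub>m n n2 @\<^sub>c mat_cnj Z2)"

definition V_tilde :: "nat \<Rightarrow> nat \<Rightarrow> nat \<Rightarrow> nat \<Rightarrow> complex mat" where
  "V_tilde na nb n1 n2 =
     diag_block_mat [Pi_mat na nb * V_mat (na + nb), V_mat n1, V_mat n2]"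

text \<open>Controllable subspace: the span of the columns of \<open>[B, AB, \<dots>, A\<^sup>N\<^sup>-\<^sup>1 B]\<close>.
  Unobservable subspace: the kernel of the stacked matrix of \<open>C, CA, \<dots>, CA\<^sup>N\<^sup>-\<^sup>1\<close>.
  For complex matrices these are complex subspaces; if the matrices are real they are the
  complexifications of the corresponding real ones.\<close>

definition vec_span :: "nat \<Rightarrow> 'a :: comm_ring_1 vec set \<Rightarrow> 'a vec set" where
  "vec_span N S = LinearCombinations.module.span class_ring (module_vec TYPE('a) N) S"

definition controllable_subspace :: "'a :: comm_ring_1 mat \<Rightarrow> 'a mat \<Rightarrow> 'a vec set" where
  "controllable_subspace A B =
     vec_span (dim_row A) (\<Union>k<dim_row A. set (cols (A ^\<^sub>m k * B)))"

definition unobservable_subspace :: "'a :: comm_ring_1 mat \<Rightarrow> 'a mat \<Rightarrow> 'a vec set" where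
  "unobservable_subspace A C =
     {v \<in> carrier_vec (dim_row A). \<forall>k<dim_row A. (C * A ^\<^sub>m k) *\<^sub>v v = 0\<^sub>v (dim_row C)}"

definition coordinate_subspace :: "nat \<Rightarrow> nat set \<Rightarrow> 'a :: comm_ring_1 vec set" where
  "coordinate_subspace N I = vec_span N (unit_vec N ` I)"

text \<open>A linear system \<open>x' = A x + B u\<close>, \<open>y = C x + D u\<close>. Its poles are the eigenvalues of \<open>A\<close>,
  whether or not they cancel in the transfer function.\<close>

datatype linear_system =
  Linear_System (sys_A: "complex mat") (sys_B: "complex mat") (sys_C: "complex mat") (sys_D: "complex mat")

definition poles :: "linear_system \<Rightarrow> complex set" where
  "poles S = spectrum (sys_A S)"

definition h_subsystem ::
  "complex mat \<Rightarrow> complex mat \<Rightarrow> complex mat \<Rightarrow> complex mat \<Rightarrow> complex mat \<Rightarrow> linear_system" where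
  "h_subsystem Ah11 Ah12 Ah22 Bh Ch =
     (let n3 = dim_row Ah11; m2 = dim_col Bh in
      Linear_System
        (Ah11 @\<^sub>c Ah12 @\<^sub>r
         0\<^sub>m n3 n3 @\<^sub>c Ah22)
        (Bh @\<^sub>r
         0\<^sub>m n3 m2)
        (0\<^sub>m m2 n3 @\<^sub>c Ch)
        (1\<^sub>m m2))"

end

theory Submission
  imports Defs
begin

text \<open>Write \<open>K = C\<^sup>\<dagger> J\<^sub>m C\<close>. The definition of \<open>A\<close> gives \<open>J\<^sub>n A = - \<i> \<Omega> - K/2\<close> with \<open>\<Omega>\<close> and \<open>K\<close>
  Hermitian, so \<open>J\<^sub>n A + (J\<^sub>n A)\<^sup>\<dagger> = - K\<close>, and unitary conjugation by the canonical transformation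
  preserves this identity. In the new coordinates \<open>J\<^sub>n\<close> becomes \<open>\<i>\<close> times a block diagonal of standard
  symplectic matrices, and \<open>K\<close> vanishes in the rows and columns of \<open>q\<^sub>h\<close> since \<open>Cbar\<close> does not see
  \<open>q\<^sub>h\<close>. The \<open>(q\<^sub>h, p\<^sub>h)\<close> block of the identity then reads \<open>Ah22 = - Ah11\<^sup>\<dagger>\<close>, and \<open>Ah11\<close> is real.\<close>

section \<open>Adjoints and block matrices\<close>

lemma dim_mat_adjoint[simp]:
  "dim_row (mat_adjoint X) = dim_col X" "dim_col (mat_adjoint X) = dim_row X"
  by (auto simp: mat_adjoint_def)

lemma mat_adjoint_carrier[simp, intro]:
  "X \<in> carrier_mat r c \<Longrightarrow> mat_adjoint X \<in> carrier_mat c r"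
  by (auto intro: carrier_matI)

lemma index_mat_adjoint[simp]:
  "i < dim_col X \<Longrightarrow> j < dim_row X \<Longrightarrow> mat_adjoint X $$ (i, j) = conjugate (X $$ (j, i))"
  by (auto simp: mat_adjoint_def mat_of_rows_def)

lemma mat_adjoint_adjoint[simp]: "mat_adjoint (mat_adjoint X) = (X :: complex mat)"
  by (rule eq_matI) auto

lemma mat_adjoint_mult:
  fixes X Y :: "complex mat"
  assumes "X \<in> carrier_mat r k" "Y \<in> carrier_mat k c"
  shows "mat_adjoint (X * Y) = mat_adjoint Y * mat_adjoint X"
  using assms by (intro eq_matI) (auto simp: scalar_prod_def mult.commute)

text \<open>A right inverse of a square matrix over a field is also a left inverse. So it is enough
  to verify one of the two unitarity equations for the quadrature transformations.\<close>

lemma mat_adjoint_mult_eq_one: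
  fixes U :: "complex mat"
  assumes "U \<in> carrier_mat k k" "U * mat_adjoint U = 1\<^sub>m k"
  shows "mat_adjoint U * U = 1\<^sub>m k"
  using mat_mult_left_right_inverse assms by blast

lemma block_diag_mult:
  assumes "P \<in> carrier_mat r1 k1" "Q \<in> carrier_mat r2 k2"
    "P' \<in> carrier_mat k1 c1" "Q' \<in> carrier_mat k2 c2"
  shows "four_block_mat P (0\<^sub>m r1 k2) (0\<^sub>m r2 k1) Q * four_block_mat P' (0\<^sub>m k1 c2) (0\<^sub>m k2 c1) Q'
    = four_block_mat (P * P') (0\<^sub>m r1 c2) (0\<^sub>m r2 c1) (Q * Q')"
  using assms by (subst mult_four_block_mat) auto

lemma block_diag_adjoint:
  fixes P Q :: "complex mat"
  assumes "P \<in> carrier_mat r1 c1" "Q \<in> carrier_mat r2 c2"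
  shows "mat_adjoint (four_block_mat P (0\<^sub>m r1 c2) (0\<^sub>m r2 c1) Q)
    = four_block_mat (mat_adjoint P) (0\<^sub>m c1 r2) (0\<^sub>m c2 r1) (mat_adjoint Q)"
  using assms by (intro eq_matI) auto

lemma dim_append_cols[simp]:
  "dim_row (X @\<^sub>c Y) = dim_row X" "dim_col (X @\<^sub>c Y) = dim_col X + dim_col Y"
  by (auto simp: append_cols_def)

lemma dim_append_rows[simp]:
  "dim_row (X @\<^sub>r Y) = dim_row X + dim_row Y" "dim_col (X @\<^sub>r Y) = dim_col X"
  by (auto simp: append_rows_def)

lemma index_append_cols[simp]:
  "i < dim_row X \<Longrightarrow> j < dim_col X + dim_col Y \<Longrightarrow>
    (X @\<^sub>c Y) $$ (i, j) = (if j < dim_col X then X $$ (i, j) else Y $$ (i, j - dim_col X))"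
  by (auto simp: append_cols_def)

lemma index_append_rows[simp]:
  "i < dim_row X + dim_row Y \<Longrightarrow> j < dim_col X \<Longrightarrow>
    (X @\<^sub>r Y) $$ (i, j) = (if i < dim_row X then X $$ (i, j) else Y $$ (i - dim_row X, j))"
  by (auto simp: append_rows_def)

section \<open>Block matrices with diagonal blocks\<close>

text \<open>Such matrices multiply like functions with values in \<open>2 \<times> 2\<close> matrices, which reduces all
  identities between \<open>J\<close>, \<open>V\<close> and \<open>\<Pi>\<close> to scalar ones.\<close>

definition diag_blocks ::
  "nat \<Rightarrow> (nat \<Rightarrow> complex) \<Rightarrow> (nat \<Rightarrow> complex) \<Rightarrow> (nat \<Rightarrow> complex) \<Rightarrow> (nat \<Rightarrow> complex) \<Rightarrow> complex mat"
  where "diag_blocks k a b c d =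
    four_block_mat (mat_diag k a) (mat_diag k b) (mat_diag k c) (mat_diag k d)"

lemma diag_blocks_carrier[simp]: "diag_blocks k a b c d \<in> carrier_mat (2 * k) (2 * k)"
  by (auto simp: diag_blocks_def mult_2 mat_diag_def intro!: carrier_matI)

lemma diag_blocks_dim[simp]:
  "dim_row (diag_blocks k a b c d) = 2 * k" "dim_col (diag_blocks k a b c d) = 2 * k"
  using diag_blocks_carrier by blast+

lemma diag_blocks_cong:
  assumes "\<And>i. i < k \<Longrightarrow> a i = a' i" "\<And>i. i < k \<Longrightarrow> b i = b' i"
    "\<And>i. i < k \<Longrightarrow> c i = c' i" "\<And>i. i < k \<Longrightarrow> d i = d' i"
  shows "diag_blocks k a b c d = diag_blocks k a' b' c' d'"
  using assms by (intro eq_matI) (auto simp: diag_blocks_def mat_diag_def)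

lemma mat_diag_add: "mat_diag k a + mat_diag k b = mat_diag k (\<lambda>i. a i + b i :: complex)"
  by (intro eq_matI) (auto simp: mat_diag_def)

lemma diag_blocks_mult:
  "diag_blocks k a b c d * diag_blocks k a' b' c' d' = diag_blocks k
    (\<lambda>i. a i * a' i + b i * c' i) (\<lambda>i. a i * b' i + b i * d' i)
    (\<lambda>i. c i * a' i + d i * c' i) (\<lambda>i. c i * b' i + d i * d' i)"
  unfolding diag_blocks_def
  by (subst mult_four_block_mat[where ?nr1.0=k and ?nr2.0=k and ?n1.0=k and ?n2.0=k
        and ?nc1.0=k and ?nc2.0=k])
    (simp_all add: mat_diag_add)

lemma diag_blocks_adjoint:
  "mat_adjoint (diag_blocks k a b c d)
    = diag_blocks k (\<lambda>i. cnj (a i)) (\<lambda>i. cnj (c i)) (\<lambda>i. cnj (b i)) (\<lambda>i. cnj (d i))"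
  by (intro eq_matI) (auto simp: diag_blocks_def mat_diag_def)

lemma diag_blocks_one: "diag_blocks k (\<lambda>_. 1) (\<lambda>_. 0) (\<lambda>_. 0) (\<lambda>_. 1) = 1\<^sub>m (2 * k)"
  by (intro eq_matI) (auto simp: diag_blocks_def mat_diag_def)

lemma J_mat_diag_blocks: "J_mat k = diag_blocks k (\<lambda>_. 1) (\<lambda>_. 0) (\<lambda>_. 0) (\<lambda>_. - 1)"
  by (intro eq_matI) (auto simp: J_mat_def diag_blocks_def mat_diag_def)

text \<open>With \<open>W = diag w\<close> this is \<open>V\<^sub>k diag(W, W\<^sup>#)\<close>; it covers both \<open>V\<^sub>k\<close> and \<open>\<Pi> V\<^sub>k\<close>.\<close>

definition quadrature_mat :: "nat \<Rightarrow> (nat \<Rightarrow> complex) \<Rightarrow> complex mat" where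
  "quadrature_mat k w = diag_blocks k
    (\<lambda>i. complex_of_real (1 / sqrt 2) * w i) (\<lambda>i. complex_of_real (1 / sqrt 2) * cnj (w i))
    (\<lambda>i. complex_of_real (1 / sqrt 2) * (- \<i> * w i)) (\<lambda>i. complex_of_real (1 / sqrt 2) * (\<i> * cnj (w i)))"

lemma V_mat_quadrature: "V_mat k = quadrature_mat k (\<lambda>_. 1)"
proof -
  have smult: "z \<cdot>\<^sub>m mat_diag k f = mat_diag k (\<lambda>i. z * f i)" for z :: complex and f
    by (intro eq_matI) (simp_all add: mat_diag_def)
  show ?thesis
    unfolding V_mat_def quadrature_mat_def diag_blocks_def mat_diag_one[symmetric] smult
      smult_four_block_mat[OF mat_diag_dim mat_diag_dim mat_diag_dim mat_diag_dim]
    by simp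
qed

text \<open>\<open>Pi_mat\<close> mixes only the coordinates i and na + nb + i. On such a pair it is
  the identity for i < na and the quarter turn with rows (0, -1) and (1, 0) otherwise.\<close>

lemma Pi_mat_diag_blocks:
  "Pi_mat na nb = diag_blocks (na + nb) (\<lambda>i. if i < na then 1 else 0) (\<lambda>i. if i < na then 0 else - 1)
    (\<lambda>i. if i < na then 0 else 1) (\<lambda>i. if i < na then 1 else 0)"
proof (rule eq_matI, goal_cases)
  case (1 i j)
  \<comment> \<open>Each index is written as an offset plus a remainder in one of the four ranges of
    lengths na, nb, na, nb; in this form the nested appends select their block by arithmetic
    alone.\<close>
  have range_cases: thesis if "l < 2 * (na + nb)" "l < na \<Longrightarrow> thesis"
    "\<And>r. l = na + r \<Longrightarrow> r < nb \<Longrightarrow> thesis" "\<And>r. l = na + (nb + r) \<Longrightarrow> r < na \<Longrightarrow> thesis"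
    "\<And>r. l = na + (nb + (na + r)) \<Longrightarrow> r < nb \<Longrightarrow> thesis" for l thesis
    using that(1) that(2) that(3)[of "l - na"] that(4)[of "l - (na + nb)"] that(5)[of "l - (na + nb + na)"]
    by (cases "l < na"; cases "l < na + nb"; cases "l < na + nb + na") simp_all
  from 1 have "i < 2 * (na + nb)" "j < 2 * (na + nb)" by simp_all
  then show ?case
    by (elim range_cases[of i] range_cases[of j]) (simp_all add: Pi_mat_def diag_blocks_def mat_diag_def)
qed (simp_all add: Pi_mat_def)

text \<open>The columns (1, \<open>- \<i>\<close>) and (1, \<open>\<i>\<close>) are eigenvectors of
  the quarter turn, with eigenvalues \<open>\<i>\<close> and \<open>- \<i>\<close>. Hence
  \<open>Pi_mat\<close> merely multiplies the phases of the last nb oscillators by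
  \<open>\<i>\<close>.\<close>

lemma Pi_V_quadrature:
  "Pi_mat na nb * V_mat (na + nb) = quadrature_mat (na + nb) (\<lambda>i. if i < na then 1 else \<i>)"
  unfolding V_mat_quadrature Pi_mat_diag_blocks quadrature_mat_def diag_blocks_mult
  by (rule diag_blocks_cong) auto

lemma half_square_inverse_sqrt2:
  "complex_of_real (1 / sqrt 2) * complex_of_real (1 / sqrt 2) = 1 / 2"
  by (simp flip: of_real_mult)

text \<open>In each 2 by 2 block both rows have squared norm (|w|^2 + |w|^2) / 2 = 1, and the two
  cross terms of their inner product cancel.\<close>

lemma quadrature_mat_unitary:
  assumes "\<And>i. w i * cnj (w i) = 1"
  shows "quadrature_mat k w * mat_adjoint (quadrature_mat k w) = 1\<^sub>m (2 * k)"
proof -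
  \<comment> \<open>The square root is kept opaque: only the square of \<open>s\<close> and its
    reality enter the computation.\<close>
  define s where "s = complex_of_real (1 / sqrt 2)"
  have s: "s * s = 1 / 2" "cnj s = s" and w: "\<And>i. w i * cnj (w i) = 1"
    using half_square_inverse_sqrt2 assms by (simp_all add: s_def)
  have "s * x * (s * y) = x * y / 2" for x y
    using s(1) by (metis (no_types, lifting) mult.assoc mult.left_commute mult_1 times_divide_eq_left)
  then show ?thesis
    unfolding quadrature_mat_def diag_blocks_adjoint diag_blocks_mult diag_blocks_one[symmetric] s_def[symmetric]
    by (intro diag_blocks_cong) (simp_all add: s w mult.commute[of "cnj _" "w _"])
qed

text \<open>Only |w|^2 survives, so the phases drop out and the result is \<open>\<i>\<close> times
  the standard symplectic matrix. This is why \<open>V_mat\<close> and its product with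
  \<open>Pi_mat\<close> lead to the same form.\<close>

lemma quadrature_mat_J:
  assumes "\<And>i. w i * cnj (w i) = 1"
  shows "quadrature_mat k w * J_mat k * mat_adjoint (quadrature_mat k w)
    = diag_blocks k (\<lambda>_. 0) (\<lambda>_. \<i>) (\<lambda>_. - \<i>) (\<lambda>_. 0)"
proof -
  define s where "s = complex_of_real (1 / sqrt 2)"
  have s: "s * s = 1 / 2" "cnj s = s" and w: "\<And>i. w i * cnj (w i) = 1"
    using half_square_inverse_sqrt2 assms by (simp_all add: s_def)
  have "s * x * (s * y) = x * y / 2" for x y
    using s(1) by (metis (no_types, lifting) mult.assoc mult.left_commute mult_1 times_divide_eq_left)
  then show ?thesis
    unfolding quadrature_mat_def J_mat_diag_blocks diag_blocks_adjoint diag_blocks_mult s_def[symmetric]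
    by (intro diag_blocks_cong) (simp_all add: s w mult.commute[of "cnj _" "w _"])
qed

section \<open>Spectra\<close>

text \<open>Complex characteristic polynomials split into linear factors, which the product rule for
  block triangular characteristic polynomials asks of both diagonal blocks.\<close>

lemma spectrum_block_triangular:
  fixes P Q R :: "complex mat"
  assumes "P \<in> carrier_mat k k" "Q \<in> carrier_mat k k" "R \<in> carrier_mat k k"
  shows "spectrum (four_block_mat P Q (0\<^sub>m k k) R) = spectrum P \<union> spectrum R"
proof -
  have "char_poly (four_block_mat P Q (0\<^sub>m k k) R) = char_poly P * char_poly R"
    using char_poly_factorized[OF assms(1)] char_poly_factorized[OF assms(3)]
    by (intro char_poly_0_block[OF refl _ _ assms]) auto
  then show ?thesis
    using assms four_block_carrier_mat[OF assms(1,3)]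
    by (auto simp: spectrum_root_char_poly[of _ k] spectrum_root_char_poly[of _ "k + k"])
qed

lemma spectrum_transpose:
  fixes P :: "complex mat"
  assumes "P \<in> carrier_mat k k"
  shows "spectrum (transpose_mat P) = spectrum P"
  using assms by (simp add: spectrum_root_char_poly[of _ k])

lemma spectrum_uminus_subset:
  fixes P :: "complex mat"
  assumes "P \<in> carrier_mat k k" "z \<in> spectrum P"
  shows "- z \<in> spectrum (- P)"
proof -
  obtain v where v: "v \<in> carrier_vec k" "v \<noteq> 0\<^sub>v k" "P *\<^sub>v v = z \<cdot>\<^sub>v v"
    using assms by (auto simp: spectrum_def eigenvalue_def eigenvector_def)
  have "(- P) *\<^sub>v v = (- z) \<cdot>\<^sub>v v"
    using v assms uminus_mult_mat_vec[of v P] by auto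
  then show ?thesis
    using v assms by (auto simp: spectrum_def eigenvalue_def eigenvector_def)
qed

lemma real_mat_cnj:
  assumes "real_mat P" "i < dim_row P" "j < dim_col P"
  shows "cnj (P $$ (i, j)) = P $$ (i, j)"
  using assms by (force simp: real_mat_def Reals_cnj_iff[symmetric])

text \<open>Conjugating an eigenvector of a real matrix gives an eigenvector for the conjugate
  eigenvalue.\<close>

lemma spectrum_cnj_real:
  assumes "P \<in> carrier_mat k k" "real_mat P" "z \<in> spectrum P"
  shows "cnj z \<in> spectrum P"
proof -
  obtain v where v: "v \<in> carrier_vec k" "v \<noteq> 0\<^sub>v k" "P *\<^sub>v v = z \<cdot>\<^sub>v v"
    using assms by (auto simp: spectrum_def eigenvalue_def eigenvector_def)
  have "P *\<^sub>v conjugate v = conjugate (P *\<^sub>v v)"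
    using v(1) assms(1) real_mat_cnj[OF assms(2)]
    by (intro eq_vecI) (auto simp: scalar_prod_def)
  also have "\<dots> = cnj z \<cdot>\<^sub>v conjugate v"
    using v by (auto simp: conjugate_smult_vec)
  finally show ?thesis
    using v assms by (auto simp: spectrum_def eigenvalue_def eigenvector_def intro!: exI[of _ "conjugate v"])
qed

section \<open>Physical realizability\<close>

lemma J_mat_carrier[simp]: "J_mat k \<in> carrier_mat (2 * k) (2 * k)"
  by (simp add: J_mat_diag_blocks)

lemma J_mat_dim[simp]: "dim_row (J_mat k) = 2 * k" "dim_col (J_mat k) = 2 * k"
  by (simp_all add: J_mat_diag_blocks)

lemma J_mat_adjoint[simp]: "mat_adjoint (J_mat k) = J_mat k"
  by (simp add: J_mat_diag_blocks diag_blocks_adjoint)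

lemma J_mat_square: "J_mat k * J_mat k = 1\<^sub>m (2 * k)"
  by (simp add: J_mat_diag_blocks diag_blocks_mult diag_blocks_one)

text \<open>Both terms of \<open>qls_A\<close> carry a left factor \<open>J_mat n\<close>, which
  squares to the identity. For Hermitian \<Omega> this splits the product into a skew-Hermitian and
  a Hermitian part.\<close>

lemma J_mult_qls_A:
  assumes C: "C \<in> carrier_mat (2 * m) (2 * n)" and \<Omega>: "\<Omega> \<in> carrier_mat (2 * n) (2 * n)"
  shows "J_mat n * qls_A n \<Omega> C = (- \<i>) \<cdot>\<^sub>m \<Omega> - (1/2) \<cdot>\<^sub>m (mat_adjoint C * J_mat m * C)"
proof -
  let ?J = "J_mat n" and ?K = "mat_adjoint C * J_mat m * C"
  have K: "?K \<in> carrier_mat (2 * n) (2 * n)"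
    using C by (metis J_mat_carrier mat_adjoint_carrier mult_carrier_mat)
  have J: "?J \<in> carrier_mat (2 * n) (2 * n)" and Jm: "J_mat m \<in> carrier_mat (2 * m) (2 * m)"
    and Cd: "mat_adjoint C \<in> carrier_mat (2 * n) (2 * m)" using C by simp_all
  have JJ: "?J * (?J * X) = X" if "X \<in> carrier_mat (2 * n) (2 * n)" for X
    using that assoc_mult_mat[OF J J that] by (simp add: J_mat_square)
  have flat: "mat_flat C * C = ?J * ?K"
    using C assoc_mult_mat[OF J Cd Jm] assoc_mult_mat[OF J _ C, of "mat_adjoint C * J_mat m"] Cd
    by (simp add: mat_flat_def)
  have "J_mat n * qls_A n \<Omega> C = ?J * ((- \<i>) \<cdot>\<^sub>m (?J * \<Omega>)) - ?J * ((1/2) \<cdot>\<^sub>m (?J * ?K))"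
    unfolding qls_A_def flat
    by (rule mult_minus_distrib_mat[OF J smult_carrier_mat smult_carrier_mat])
      (rule mult_carrier_mat[OF J \<Omega>] mult_carrier_mat[OF J K])+
  also have "?J * ((- \<i>) \<cdot>\<^sub>m (?J * \<Omega>)) = (- \<i>) \<cdot>\<^sub>m \<Omega>"
    using \<Omega> J by (subst mult_smult_distrib[of _ "2*n" "2*n" _ "2*n"]) (auto simp: JJ mult_carrier_mat[OF J \<Omega>])
  also have "?J * ((1/2) \<cdot>\<^sub>m (?J * ?K)) = (1/2) \<cdot>\<^sub>m ?K"
    using K J by (subst mult_smult_distrib[of _ "2*n" "2*n" _ "2*n"]) (auto simp: JJ mult_carrier_mat[OF J K])
  finally show ?thesis .
qed

text \<open>Adding the adjoint cancels the skew-Hermitian part and doubles the Hermitian one. With A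
  = \<open>qls_A n \<Omega> C\<close>, this is \<open>J_mat n\<close> times the familiar identity
  \<open>A + mat_flat A + mat_flat C * C = 0\<close>.\<close>

lemma physical_realizability:
  assumes C: "C \<in> carrier_mat (2 * m) (2 * n)" and \<Omega>: "\<Omega> \<in> carrier_mat (2 * n) (2 * n)"
    and herm: "mat_adjoint \<Omega> = \<Omega>"
  shows "J_mat n * qls_A n \<Omega> C + mat_adjoint (J_mat n * qls_A n \<Omega> C)
    = - (mat_adjoint C * J_mat m * C)"
proof -
  let ?K = "mat_adjoint C * J_mat m * C"
  have K: "?K \<in> carrier_mat (2 * n) (2 * n)"
    using C by (metis J_mat_carrier mat_adjoint_carrier mult_carrier_mat)
  have Jm: "J_mat m \<in> carrier_mat (2 * m) (2 * m)"
    and Cd: "mat_adjoint C \<in> carrier_mat (2 * n) (2 * m)" using C by simp_all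
  have "mat_adjoint ?K = ?K"
    using mat_adjoint_mult[OF _ C, of "mat_adjoint C * J_mat m"] mat_adjoint_mult[OF Cd Jm]
      assoc_mult_mat[OF Cd Jm C] mult_carrier_mat[OF Cd Jm] by simp
  then have K_entry: "cnj (?K $$ (j, i)) = ?K $$ (i, j)" if "i < 2*n" "j < 2*n" for i j
    using that K index_mat_adjoint[of i ?K j] by auto
  have \<Omega>_entry: "cnj (\<Omega> $$ (j, i)) = \<Omega> $$ (i, j)" if "i < 2*n" "j < 2*n" for i j
    using that \<Omega> herm index_mat_adjoint[of i \<Omega> j] by auto
  show ?thesis
    unfolding J_mult_qls_A[OF C \<Omega>]
  proof (rule eq_matI, goal_cases)
    case (1 i j)
    then have ij: "i < 2*n" "j < 2*n" using K by auto
    show ?case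
      using ij \<Omega> K K_entry[OF ij] \<Omega>_entry[OF ij]
      by (simp del: index_mult_mat)
  qed (use K \<Omega> in auto)
qed

section \<open>The canonical coordinates\<close>

lemma V_mat_carrier[simp]: "V_mat k \<in> carrier_mat (2 * k) (2 * k)"
  by (simp add: V_mat_quadrature quadrature_mat_def)

lemma V_mat_unitary: "V_mat k * mat_adjoint (V_mat k) = 1\<^sub>m (2 * k)"
  unfolding V_mat_quadrature by (rule quadrature_mat_unitary) simp

lemma V_mat_J: "V_mat k * J_mat k * mat_adjoint (V_mat k)
    = diag_blocks k (\<lambda>_. 0) (\<lambda>_. \<i>) (\<lambda>_. - \<i>) (\<lambda>_. 0)"
  unfolding V_mat_quadrature by (rule quadrature_mat_J) simp

lemma Pi_V_carrier: "Pi_mat na nb * V_mat (na + nb) \<in> carrier_mat (2 * (na + nb)) (2 * (na + nb))"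
  unfolding Pi_V_quadrature quadrature_mat_def by (rule diag_blocks_carrier)

lemma Pi_V_unitary:
  "(Pi_mat na nb * V_mat (na + nb)) * mat_adjoint (Pi_mat na nb * V_mat (na + nb))
    = 1\<^sub>m (2 * (na + nb))"
  unfolding Pi_V_quadrature by (rule quadrature_mat_unitary) simp

lemma Pi_V_J:
  "(Pi_mat na nb * V_mat (na + nb)) * J_mat (na + nb) * mat_adjoint (Pi_mat na nb * V_mat (na + nb))
    = diag_blocks (na + nb) (\<lambda>_. 0) (\<lambda>_. \<i>) (\<lambda>_. - \<i>) (\<lambda>_. 0)"
  unfolding Pi_V_quadrature by (rule quadrature_mat_J) simp

text \<open>The nesting separates the first block, later that of (q_h, p_h), from the other two
  taken together.\<close>

lemma diag_block_mat_three:
  assumes "X \<in> carrier_mat k k" "Y \<in> carrier_mat r r" "Z \<in> carrier_mat s s"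
  shows "diag_block_mat [X, Y, Z] = four_block_mat X (0\<^sub>m k (r + s)) (0\<^sub>m (r + s) k)
    (four_block_mat Y (0\<^sub>m r s) (0\<^sub>m s r) Z)"
  using assms by (auto simp: Let_def)

lemma diag_block_mat_three_carrier:
  assumes "X \<in> carrier_mat k k" "Y \<in> carrier_mat r r" "Z \<in> carrier_mat s s"
  shows "diag_block_mat [X, Y, Z] \<in> carrier_mat (k + (r + s)) (k + (r + s))"
  using assms by (simp add: diag_block_mat_three del: diag_block_mat.simps)

lemma diag_block_mat_three_mult:
  fixes X Y Z X' Y' Z' :: "complex mat"
  assumes "X \<in> carrier_mat k k" "Y \<in> carrier_mat r r" "Z \<in> carrier_mat s s"
    and "X' \<in> carrier_mat k k" "Y' \<in> carrier_mat r r" "Z' \<in> carrier_mat s s"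
  shows "diag_block_mat [X, Y, Z] * diag_block_mat [X', Y', Z'] = diag_block_mat [X * X', Y * Y', Z * Z']"
  unfolding diag_block_mat_three[OF assms(1-3)] diag_block_mat_three[OF assms(4-6)]
    diag_block_mat_three[OF mult_carrier_mat[OF assms(1,4)] mult_carrier_mat[OF assms(2,5)]
      mult_carrier_mat[OF assms(3,6)]]
    block_diag_mult[OF assms(1) four_block_carrier_mat[OF assms(2,3)] assms(4)
      four_block_carrier_mat[OF assms(5,6)]]
    block_diag_mult[OF assms(2,3,5,6)] ..

lemma diag_block_mat_three_conj:
  fixes X Y Z X' Y' Z' :: "complex mat"
  assumes "X \<in> carrier_mat k k" "Y \<in> carrier_mat r r" "Z \<in> carrier_mat s s"
    and "X' \<in> carrier_mat k k" "Y' \<in> carrier_mat r r" "Z' \<in> carrier_mat s s"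
  shows "diag_block_mat [X, Y, Z] * diag_block_mat [X', Y', Z'] * mat_adjoint (diag_block_mat [X, Y, Z])
    = diag_block_mat [X * X' * mat_adjoint X, Y * Y' * mat_adjoint Y, Z * Z' * mat_adjoint Z]"
proof -
  have c: "X * X' \<in> carrier_mat k k" "Y * Y' \<in> carrier_mat r r" "Z * Z' \<in> carrier_mat s s"
    and d: "mat_adjoint X \<in> carrier_mat k k" "mat_adjoint Y \<in> carrier_mat r r"
      "mat_adjoint Z \<in> carrier_mat s s"
    using assms mult_carrier_mat by auto
  have "diag_block_mat [X, Y, Z] * diag_block_mat [X', Y', Z'] = diag_block_mat [X * X', Y * Y', Z * Z']"
    by (rule diag_block_mat_three_mult[OF assms])
  moreover have "mat_adjoint (diag_block_mat [X, Y, Z])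
      = diag_block_mat [mat_adjoint X, mat_adjoint Y, mat_adjoint Z]"
    unfolding diag_block_mat_three[OF assms(1-3)] diag_block_mat_three[OF d]
      block_diag_adjoint[OF assms(1) four_block_carrier_mat[OF assms(2,3)]]
      block_diag_adjoint[OF assms(2,3)] ..
  ultimately show ?thesis
    using diag_block_mat_three_mult[OF c d] by (simp only:)
qed

lemma V_tilde_carrier:
  "V_tilde na nb n1 n2 \<in> carrier_mat (2 * (n1 + n2 + (na + nb))) (2 * (n1 + n2 + (na + nb)))"
proof -
  have "2 * (n1 + n2 + (na + nb)) = 2 * (na + nb) + (2 * n1 + 2 * n2)" by simp
  then show ?thesis
    using diag_block_mat_three_carrier[OF Pi_V_carrier V_mat_carrier V_mat_carrier]
    unfolding V_tilde_def by (simp only:)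
qed

lemma V_tilde_unitary:
  "V_tilde na nb n1 n2 * mat_adjoint (V_tilde na nb n1 n2) = 1\<^sub>m (2 * (n1 + n2 + (na + nb)))"
proof -
  \<comment> \<open>Unitarity is the conjugation formula for three blocks with identities in the
    middle.\<close>
  let ?I = "diag_block_mat [1\<^sub>m (2 * (na + nb)), 1\<^sub>m (2 * n1), 1\<^sub>m (2 * n2)] :: complex mat"
  have I: "?I = 1\<^sub>m (2 * (n1 + n2 + (na + nb)))"
    by (subst diag_block_mat_three) (auto simp: algebra_simps)
  have "V_tilde na nb n1 n2 * ?I * mat_adjoint (V_tilde na nb n1 n2) = ?I"
    unfolding V_tilde_def
    by (subst diag_block_mat_three_conj[OF Pi_V_carrier V_mat_carrier V_mat_carrier])
      (simp_all only: one_carrier_mat right_mult_one_mat[OF Pi_V_carrier]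
        right_mult_one_mat[OF V_mat_carrier] Pi_V_unitary V_mat_unitary)
  then show ?thesis
    unfolding I by (simp only: right_mult_one_mat[OF V_tilde_carrier])
qed

text \<open>The (q_h, p_h) block is made explicit because its entries are compared later;
  \<open>L\<close> gathers the forms of the remaining modes.\<close>

lemma V_tilde_J:
  obtains L where "L \<in> carrier_mat (2 * (n1 + n2)) (2 * (n1 + n2))"
    and "V_tilde na nb n1 n2 * diag_block_mat [J_mat (na + nb), J_mat n1, J_mat n2]
        * mat_adjoint (V_tilde na nb n1 n2)
      = four_block_mat (diag_blocks (na + nb) (\<lambda>_. 0) (\<lambda>_. \<i>) (\<lambda>_. - \<i>) (\<lambda>_. 0))
          (0\<^sub>m (2 * (na + nb)) (2 * (n1 + n2))) (0\<^sub>m (2 * (n1 + n2)) (2 * (na + nb))) L"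
proof -
  let ?D = "\<lambda>k. diag_blocks k (\<lambda>_. 0) (\<lambda>_. \<i>) (\<lambda>_. - \<i>) (\<lambda>_. 0)"
  let ?L = "four_block_mat (?D n1) (0\<^sub>m (2 * n1) (2 * n2)) (0\<^sub>m (2 * n2) (2 * n1)) (?D n2)"
  have "?L \<in> carrier_mat (2 * (n1 + n2)) (2 * (n1 + n2))"
    by (auto intro!: carrier_matI)
  moreover have "V_tilde na nb n1 n2 * diag_block_mat [J_mat (na + nb), J_mat n1, J_mat n2]
        * mat_adjoint (V_tilde na nb n1 n2) = diag_block_mat [?D (na + nb), ?D n1, ?D n2]"
    unfolding V_tilde_def
    by (subst diag_block_mat_three_conj[OF Pi_V_carrier V_mat_carrier V_mat_carrier])
      (simp_all only: J_mat_carrier Pi_V_J V_mat_J)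
  moreover have "diag_block_mat [?D (na + nb), ?D n1, ?D n2]
      = four_block_mat (?D (na + nb)) (0\<^sub>m (2 * (na + nb)) (2 * n1 + 2 * n2))
          (0\<^sub>m (2 * n1 + 2 * n2) (2 * (na + nb))) ?L"
    by (intro diag_block_mat_three diag_blocks_carrier)
  moreover have "2 * n1 + 2 * n2 = 2 * (n1 + n2)" by simp
  ultimately show thesis
    using that[of ?L] by (simp only:)
qed

text \<open>The first 2k rows of \<open>G\<close> are multiples of unit vectors, so multiplying by
  \<open>G\<close> from the left exchanges the q rows and the p rows of \<open>M\<close>, up to a
  factor \<open>\<i>\<close> or \<open>- \<i>\<close>.\<close>

lemma quadrature_form_mult:
  assumes L: "L \<in> carrier_mat r r" and M: "M \<in> carrier_mat (2 * k + r) c" and i: "i < k" and j: "j < c"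
    and G: "G = four_block_mat (diag_blocks k (\<lambda>_. 0) (\<lambda>_. \<i>) (\<lambda>_. - \<i>) (\<lambda>_. 0))
      (0\<^sub>m (2 * k) r) (0\<^sub>m r (2 * k)) L"
  shows "(G * M) $$ (i, j) = \<i> * M $$ (k + i, j)"
    and "(G * M) $$ (k + i, j) = - \<i> * M $$ (i, j)"
proof -
  have row1: "row G i = \<i> \<cdot>\<^sub>v unit_vec (2 * k + r) (k + i)"
    and row2: "row G (k + i) = (- \<i>) \<cdot>\<^sub>v unit_vec (2 * k + r) i"
    using i L unfolding G
    by (auto intro!: eq_vecI simp: diag_blocks_def mat_diag_def)
  have col: "col M j \<in> carrier_vec (2 * k + r)"
    using M by (intro carrier_vecI) simp
  have dim: "dim_row G = 2 * k + r" using L G by simp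
  have "(G * M) $$ (i, j) = row G i \<bullet> col M j" "(G * M) $$ (k + i, j) = row G (k + i) \<bullet> col M j"
    using dim i j M by simp_all
  then show "(G * M) $$ (i, j) = \<i> * M $$ (k + i, j)"
    and "(G * M) $$ (k + i, j) = - \<i> * M $$ (i, j)"
    unfolding row1 row2 using col i j M
    by (simp_all add: smult_scalar_prod_distrib[of _ "2 * k + r"])
qed

text \<open>The inner factor \<open>H * mat_adjoint H\<close> collapses to the identity.\<close>

lemma unitary_conj_mult:
  fixes H P Q :: "complex mat"
  assumes H: "H \<in> carrier_mat k k" "H * mat_adjoint H = 1\<^sub>m k"
    and P: "P \<in> carrier_mat k k" and Q: "Q \<in> carrier_mat k k"
  shows "(mat_adjoint H * P * H) * (mat_adjoint H * Q * H) = mat_adjoint H * (P * Q) * H"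
proof -
  have Hd: "mat_adjoint H \<in> carrier_mat k k" using H by simp
  note c = mult_carrier_mat[of _ k k _ k]
  have "(mat_adjoint H * P * H) * (mat_adjoint H * Q * H)
      = mat_adjoint H * P * (H * mat_adjoint H) * Q * H"
    using Hd H(1) P Q by (simp add: assoc_mult_mat[of _ k k _ k _ k] c)
  also have "\<dots> = mat_adjoint H * (P * Q) * H"
    unfolding H(2) using Hd H(1) P Q by (simp add: assoc_mult_mat[of _ k k _ k _ k] c right_mult_one_mat[of _ k k])
  finally show ?thesis .
qed

text \<open>Taking adjoints commutes with the congruence by \<open>H\<close>; this carries the
  realizability identity to the new coordinates.\<close>

lemma unitary_conj_add_adjoint:
  fixes H X :: "complex mat"
  assumes H: "H \<in> carrier_mat k k" and X: "X \<in> carrier_mat k k"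
  shows "mat_adjoint H * X * H + mat_adjoint (mat_adjoint H * X * H)
    = mat_adjoint H * (X + mat_adjoint X) * H"
proof -
  have Hd: "mat_adjoint H \<in> carrier_mat k k" and Xd: "mat_adjoint X \<in> carrier_mat k k"
    using H X by simp_all
  note c = mult_carrier_mat[of _ k k _ k]
  have "mat_adjoint (mat_adjoint H * X * H) = mat_adjoint H * mat_adjoint X * H"
    using H Hd X Xd mat_adjoint_mult[of "mat_adjoint H * X" k k H k] mat_adjoint_mult[OF Hd X]
    by (simp add: c assoc_mult_mat[of _ k k _ k _ k])
  note e = this
  show ?thesis
    unfolding e using H Hd X Xd
    by (simp add: c mult_add_distrib_mat[of _ k k _ k] add_mult_distrib_mat[of _ k k _ _ k])
qed

lemma mult_mat_zero_col:
  assumes "P \<in> carrier_mat r k" "Q \<in> carrier_mat k c" "i < r" "j < c"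
    and "\<And>l. l < k \<Longrightarrow> Q $$ (l, j) = (0 :: complex)"
  shows "(P * Q) $$ (i, j) = 0"
  using assms by (auto simp: scalar_prod_def)

lemma mult_mat_zero_row:
  assumes "P \<in> carrier_mat r k" "Q \<in> carrier_mat k c" "i < r" "j < c"
    and "\<And>l. l < k \<Longrightarrow> P $$ (i, l) = (0 :: complex)"
  shows "(P * Q) $$ (i, j) = 0"
  using assms by (auto simp: scalar_prod_def)

theorem proposition3p3:
  fixes m n n1 n2 n3 na nb :: nat
    and \<Delta> :: "complex mat \<Rightarrow> complex mat \<Rightarrow> complex mat"
    and Cminus Cplus \<Omega>minus \<Omega>plus :: "complex mat"
    and C \<Omega> A B :: "complex mat"
    and Z1 Z2 Z3 T That :: "complex mat"
    and Abar Bbar Cbar :: "complex mat"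
    and Ah11 Ah12 Ah22 A12 A13 A21 A31 Aco Acobar :: "complex mat"
    and Bh Bco Ch Cco :: "complex mat"
  assumes Delta: "\<Delta> \<in> {Delta, Delta_printed}"
    and Cminus: "Cminus \<in> carrier_mat m n" and Cplus: "Cplus \<in> carrier_mat m n"
    and Omega_minus: "\<Omega>minus \<in> carrier_mat n n" and Omega_plus: "\<Omega>plus \<in> carrier_mat n n"
    and C: "C = \<Delta> Cminus Cplus"
    and Omega: "\<Omega> = \<Delta> \<Omega>minus \<Omega>plus"
    and hermitian: "mat_adjoint \<Omega> = \<Omega>"
    and A: "A = qls_A n \<Omega> C"
    and B: "B = qls_B C"
    and n: "n = n1 + n2 + n3" and n3: "n3 = na + nb"
    and Z: "Z1 \<in> carrier_mat n n1" "Z2 \<in> carrier_mat n n2" "Z3 \<in> carrier_mat n n3"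
    and T: "T = T_mat Z1 Z2 Z3"
    and T_unitary: "unitary_mat T"
    and T_J: "mat_adjoint T * J_mat n * T = diag_block_mat [J_mat n3, J_mat n1, J_mat n2]"
    and That: "That = T * mat_adjoint (V_tilde na nb n1 n2)"
    and Abar: "Abar = mat_adjoint That * A * That"
    and Bbar: "Bbar = mat_adjoint That * B * mat_adjoint (V_mat m)"
    and Cbar: "Cbar = V_mat m * C * That"
    and real: "real_mat Abar" "real_mat Bbar" "real_mat Cbar"
    and A_dims:
      "Ah11 \<in> carrier_mat n3 n3" "Ah12 \<in> carrier_mat n3 n3" "Ah22 \<in> carrier_mat n3 n3"
      "A12 \<in> carrier_mat n3 (2*n1)" "A13 \<in> carrier_mat n3 (2*n2)"
      "A21 \<in> carrier_mat (2*n1) n3" "A31 \<in> carrier_mat (2*n2) n3"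
      "Aco \<in> carrier_mat (2*n1) (2*n1)" "Acobar \<in> carrier_mat (2*n2) (2*n2)"
    and B_dims: "Bh \<in> carrier_mat n3 (2*m)" "Bco \<in> carrier_mat (2*n1) (2*m)"
    and C_dims: "Ch \<in> carrier_mat (2*m) n3" "Cco \<in> carrier_mat (2*m) (2*n1)"
    and Abar_blocks: "Abar =
      (Ah11            @\<^sub>c Ah12 @\<^sub>c A12                 @\<^sub>c A13                 @\<^sub>r
       0\<^sub>m n3 n3     @\<^sub>c Ah22 @\<^sub>c 0\<^sub>m n3 (2*n1)     @\<^sub>c 0\<^sub>m n3 (2*n2)     @\<^sub>r
       0\<^sub>m (2*n1) n3 @\<^sub>c A21  @\<^sub>c Aco                 @\<^sub>c 0\<^sub>m (2*n1) (2*n2) @\<^sub>r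
       0\<^sub>m (2*n2) n3 @\<^sub>c A31  @\<^sub>c 0\<^sub>m (2*n2) (2*n1) @\<^sub>c Acobar)"
    and Bbar_blocks: "Bbar = (Bh @\<^sub>r 0\<^sub>m n3 (2*m) @\<^sub>r Bco @\<^sub>r 0\<^sub>m (2*n2) (2*m))"
    and Cbar_blocks: "Cbar = (0\<^sub>m (2*m) n3 @\<^sub>c Ch @\<^sub>c Cco @\<^sub>c 0\<^sub>m (2*m) (2*n2))"
    and controllable: "controllable_subspace Abar Bbar =
      coordinate_subspace (2*n) ({..<n3} \<union> {2*n3..<2*n3 + 2*n1})"
    and unobservable: "unobservable_subspace Abar Cbar =
      coordinate_subspace (2*n) ({..<n3} \<union> {2*n3 + 2*n1..<2*n})"
  shows "poles (h_subsystem Ah11 Ah12 Ah22 Bh Ch) = spectrum Ah11 \<union> spectrum (- Ah11)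
    \<and> (\<forall>p \<in> poles (h_subsystem Ah11 Ah12 Ah22 Bh Ch).
         - p \<in> poles (h_subsystem Ah11 Ah12 Ah22 Bh Ch)
       \<and> cnj p \<in> poles (h_subsystem Ah11 Ah12 Ah22 Bh Ch)
       \<and> - cnj p \<in> poles (h_subsystem Ah11 Ah12 Ah22 Bh Ch))"
proof -

  \<comment> \<open>Dimensions and unitarity of the canonical transformation\<close>
  let ?H = "mat_adjoint That" and ?N = "2 * n" and ?J = "J_mat n" and ?W = "V_tilde na nb n1 n2"
  let ?D = "diag_block_mat [J_mat n3, J_mat n1, J_mat n2]"
  have C_dim: "C \<in> carrier_mat (2 * m) (2 * n)" and \<Omega>_dim: "\<Omega> \<in> carrier_mat (2 * n) (2 * n)"
    using Delta Cminus Cplus Omega_minus Omega_plus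
    by (auto simp: C Omega Delta_def Delta_printed_def mat_cnj_def)
  have flat_dim: "mat_flat C \<in> carrier_mat ?N (2 * m)"
    using C_dim J_mat_carrier[of m] J_mat_carrier[of n] by (auto simp: mat_flat_def intro!: carrier_matI)
  have A_dim: "A \<in> carrier_mat ?N ?N"
    unfolding A qls_A_def using C_dim \<Omega>_dim flat_dim J_mat_carrier[of n] by (auto intro!: carrier_matI)
  have J_dim: "?J \<in> carrier_mat ?N ?N" by simp
  have T_dim: "T \<in> carrier_mat ?N ?N"
    using Z by (auto simp: T T_mat_def Let_def mat_cnj_def n intro!: carrier_matI)
  have TT: "T * mat_adjoint T = 1\<^sub>m ?N"
    using T_unitary T_dim by (auto simp: unitary_mat_def)
  have W_dim: "?W \<in> carrier_mat ?N ?N"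
    using V_tilde_carrier[of na nb n1 n2] by (simp only: n n3)
  have WW: "mat_adjoint ?W * ?W = 1\<^sub>m ?N"
    using V_tilde_unitary[of na nb n1 n2] W_dim mat_adjoint_mult_eq_one[OF W_dim] by (simp only: n n3)
  have Td: "mat_adjoint T \<in> carrier_mat ?N ?N" and Wd: "mat_adjoint ?W \<in> carrier_mat ?N ?N"
    using T_dim W_dim by simp_all
  have That_dim: "That \<in> carrier_mat ?N ?N" and Hd: "?H \<in> carrier_mat ?N ?N"
    unfolding That using mult_carrier_mat[OF T_dim Wd] by simp_all
  have H: "?H = ?W * mat_adjoint T"
    unfolding That by (simp add: mat_adjoint_mult[OF T_dim Wd])
  note c = mult_carrier_mat[of _ ?N ?N _ ?N] and a = assoc_mult_mat[of _ ?N ?N _ ?N _ ?N]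
  \<comment> \<open>The product telescopes: first the quadrature factors cancel, then
    \<open>T\<close> and its adjoint.\<close>
  have "That * ?H = T * (mat_adjoint ?W * ?W) * mat_adjoint T"
    unfolding H unfolding That using T_dim Td W_dim Wd by (simp add: a c)
  then have unit: "That * ?H = 1\<^sub>m ?N"
    unfolding WW using T_dim TT by (simp add: right_mult_one_mat[OF T_dim])

  \<comment> \<open>The form J in canonical coordinates\<close>
  define Jbar where "Jbar = ?H * ?J * That"
  \<comment> \<open>Regrouping lets \<open>T\<close> act first, which turns \<open>J_mat n\<close>
    into the block diagonal \<open>?D\<close>; only then do the quadratures act.\<close>
  have "Jbar = ?W * (mat_adjoint T * ?J * T) * mat_adjoint ?W"
    unfolding Jbar_def H unfolding That using T_dim Td W_dim Wd J_dim by (simp add: a c)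
  then have Jbar_W: "Jbar = ?W * ?D * mat_adjoint ?W"
    unfolding T_J .
  obtain L where L: "L \<in> carrier_mat (2 * (n1 + n2)) (2 * (n1 + n2))"
    and Jbar: "Jbar = four_block_mat (diag_blocks n3 (\<lambda>_. 0) (\<lambda>_. \<i>) (\<lambda>_. - \<i>) (\<lambda>_. 0))
      (0\<^sub>m (2 * n3) (2 * (n1 + n2))) (0\<^sub>m (2 * (n1 + n2)) (2 * n3)) L"
    using V_tilde_J[of n1 n2 na nb] unfolding Jbar_W n3 by metis

  \<comment> \<open>The realizability identity in canonical coordinates\<close>
  define X where "X = ?J * A"
  define K where "K = mat_adjoint C * J_mat m * C"
  have X_dim: "X \<in> carrier_mat ?N ?N" unfolding X_def using mult_carrier_mat[OF J_dim A_dim] .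
  have Cd: "mat_adjoint C \<in> carrier_mat ?N (2 * m)" and Jm: "J_mat m \<in> carrier_mat (2 * m) (2 * m)"
    using C_dim by simp_all
  note CJ = mult_carrier_mat[OF Cd Jm]
  have K_dim: "K \<in> carrier_mat ?N ?N" unfolding K_def using mult_carrier_mat[OF CJ C_dim] .
  have Abar_dim: "Abar \<in> carrier_mat ?N ?N"
    unfolding Abar using Hd A_dim That_dim by (intro c) auto
  have S: "Jbar * Abar = ?H * X * That"
    unfolding Jbar_def Abar X_def by (rule unitary_conj_mult[OF That_dim unit J_dim A_dim])
  have "Jbar * Abar + mat_adjoint (Jbar * Abar) = ?H * (- K) * That"
    unfolding S unitary_conj_add_adjoint[OF That_dim X_dim]
    unfolding X_def A K_def by (simp add: physical_realizability[OF C_dim \<Omega>_dim hermitian])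
  also have "\<dots> = - (?H * K * That)"
    using Hd K_dim That_dim mult_carrier_mat[OF Hd K_dim] by simp
  finally have S_sum: "Jbar * Abar + mat_adjoint (Jbar * Abar) = - (?H * K * That)" .

  \<comment> \<open>Vanishing of the coupling term on the q_h rows\<close>
  let ?CT = "C * That"
  have CT_dim: "?CT \<in> carrier_mat (2 * m) ?N" using mult_carrier_mat[OF C_dim That_dim] .
  have Vd: "mat_adjoint (V_mat m) \<in> carrier_mat (2 * m) (2 * m)" by simp
  have VV: "mat_adjoint (V_mat m) * V_mat m = 1\<^sub>m (2 * m)"
    by (rule mat_adjoint_mult_eq_one[OF V_mat_carrier V_mat_unitary])
  have Cbar_CT: "Cbar = V_mat m * ?CT"
    unfolding Cbar by (rule assoc_mult_mat[OF V_mat_carrier C_dim That_dim])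
  have Cbar_dim: "Cbar \<in> carrier_mat (2 * m) ?N"
    unfolding Cbar_CT by (rule mult_carrier_mat[OF V_mat_carrier CT_dim])
  \<comment> \<open>Undoing the output rotation \<open>V_mat m\<close> moves the zero columns of
    \<open>Cbar\<close> to \<open>C * That\<close>, the factor that occurs in the transformed
    \<open>K\<close>.\<close>
  have CT_Cbar: "?CT = mat_adjoint (V_mat m) * Cbar"
    unfolding Cbar_CT using assoc_mult_mat[OF Vd V_mat_carrier CT_dim] left_mult_one_mat[OF CT_dim] by (simp add: VV)
  have n3_le: "2 * n3 \<le> ?N" by (simp add: n)
  have Cbar_zero: "Cbar $$ (l, j) = 0" if "l < 2 * m" "j < n3" for l j
    using that C_dims n by (simp add: Cbar_blocks)
  have CT_zero: "?CT $$ (l, j) = 0" if "l < 2 * m" "j < n3" for l j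
    unfolding CT_Cbar using that n3_le Cbar_zero by (intro mult_mat_zero_col[OF Vd Cbar_dim]) auto
  \<comment> \<open>With the adjoint of \<open>C * That\<close> as left factor, zero columns of
    \<open>C * That\<close> become zero rows of the whole product.\<close>
  have HKT: "?H * K * That = mat_adjoint ?CT * (J_mat m * ?CT)"
    unfolding K_def mat_adjoint_mult[OF C_dim That_dim]
    using assoc_mult_mat[OF Hd CJ C_dim] assoc_mult_mat[OF mult_carrier_mat[OF Hd CJ] C_dim That_dim]
      assoc_mult_mat[OF Hd Cd Jm] assoc_mult_mat[OF mult_carrier_mat[OF Hd Cd] Jm CT_dim]
    by simp
  have CT_adjoint_zero: "mat_adjoint ?CT $$ (i, l) = 0" if "i < n3" "l < 2 * m" for i l
  proof -
    have "i < dim_col ?CT" "l < dim_row ?CT" using that n3_le carrier_matD[OF CT_dim] by linarith+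
    then show ?thesis using CT_zero[OF that(2,1)] by (simp only: index_mat_adjoint conjugate_zero)
  qed
  have HKT_zero: "(?H * K * That) $$ (i, j) = 0" if "i < n3" "j < ?N" for i j
    unfolding HKT using that n3_le CT_adjoint_zero
    by (intro mult_mat_zero_row[OF mat_adjoint_carrier[OF CT_dim] mult_carrier_mat[OF Jm CT_dim]]) auto

  \<comment> \<open>The relation between the diagonal blocks of the h subsystem\<close>
  have N: "?N = 2 * n3 + 2 * (n1 + n2)" by (simp add: n)
  have Jbar_dim: "Jbar \<in> carrier_mat ?N ?N"
    unfolding Jbar_def using Hd J_dim That_dim by (intro c) auto
  have Abar_real: "cnj (Abar $$ (i, j)) = Abar $$ (i, j)" if "i < ?N" "j < ?N" for i j
    using real_mat_cnj[OF real(1)] Abar_dim that by auto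
  have Abar_rel: "Abar $$ (n3 + i, n3 + j) = - Abar $$ (j, i)" if "i < n3" "j < n3" for i j
  proof -
    have lt: "i < ?N" "n3 + j < ?N" "n3 + i < ?N" "j < ?N" using that n3_le by auto
    note form = quadrature_form_mult[OF L Abar_dim[unfolded N] _ _ Jbar, folded N]
    \<comment> \<open>Entry (i, n3 + j) pairs a q_h row with a p_h column. There
      \<open>Jbar * Abar\<close> has the entry \<open>\<i> * Abar $$ (n3 + i, n3 + j)\<close>; its
      mirrored entry \<open>- \<i> * Abar $$ (j, i)\<close> conjugates to
      \<open>\<i> * Abar $$ (j, i)\<close> because \<open>Abar\<close> is real.\<close>
    have "(Jbar * Abar) $$ (i, n3 + j) + cnj ((Jbar * Abar) $$ (n3 + j, i)) = 0"
      using arg_cong[OF S_sum, of "\<lambda>M. M $$ (i, n3 + j)"] HKT_zero[of i "n3 + j"] lt that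
        Jbar_dim Abar_dim Hd That_dim
      by (simp del: index_mult_mat(1))
    then have "\<i> * (Abar $$ (n3 + i, n3 + j) + Abar $$ (j, i)) = 0"
      using form(1)[OF that(1) lt(2)] form(2)[OF that(2) lt(1)] Abar_real[OF lt(4,1)]
      by (simp add: distrib_left)
    then show ?thesis
      by (simp add: add_eq_0_iff)
  qed
  have Ah11_entry: "Ah11 $$ (i, j) = Abar $$ (i, j)"
    and Ah22_entry: "Ah22 $$ (i, j) = Abar $$ (n3 + i, n3 + j)" if "i < n3" "j < n3" for i j
    using that A_dims n by (simp_all add: Abar_blocks)
  have Ah22: "Ah22 = - transpose_mat Ah11"
    using A_dims by (intro eq_matI) (simp_all add: Ah11_entry Ah22_entry Abar_rel)
  have Ah11_real: "real_mat Ah11"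
    unfolding real_mat_def
    using A_dims(1) n3_le Ah11_entry Abar_real by (auto simp: Reals_cnj_iff)

  \<comment> \<open>The poles and their symmetries\<close>
  have "- transpose_mat Ah11 = transpose_mat (- Ah11)"
    by (intro eq_matI) auto
  then have spec22: "spectrum Ah22 = spectrum (- Ah11)"
    unfolding Ah22 using spectrum_transpose[of "- Ah11" n3] A_dims(1) by simp
  have "sys_A (h_subsystem Ah11 Ah12 Ah22 Bh Ch) = four_block_mat Ah11 Ah12 (0\<^sub>m n3 n3) Ah22"
    using A_dims by (intro eq_matI) (auto simp: h_subsystem_def Let_def)
  then have poles: "poles (h_subsystem Ah11 Ah12 Ah22 Bh Ch) = spectrum Ah11 \<union> spectrum (- Ah11)"
    unfolding poles_def using spectrum_block_triangular[OF A_dims(1-3)] spec22 by simp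
  have neg: "- p \<in> spectrum Ah11 \<union> spectrum (- Ah11)" if "p \<in> spectrum Ah11 \<union> spectrum (- Ah11)" for p
    using that spectrum_uminus_subset[OF A_dims(1)] spectrum_uminus_subset[of "- Ah11" n3] A_dims(1)
    by auto
  have "cnj p \<in> spectrum Ah11 \<union> spectrum (- Ah11)" if "p \<in> spectrum Ah11 \<union> spectrum (- Ah11)" for p
    using that
  proof
    \<comment> \<open>Conjugation is available on the spectrum of the real matrix
      \<open>Ah11\<close>, so the pole is negated into it, conjugated there and negated
      back.\<close>
    assume "p \<in> spectrum (- Ah11)"
    then have "- p \<in> spectrum Ah11"
      using spectrum_uminus_subset[of "- Ah11" n3 p] A_dims(1) by simp
    then have "- cnj p \<in> spectrum Ah11"
      using spectrum_cnj_real[OF A_dims(1) Ah11_real] by force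
    then show ?thesis
      using neg[of "- cnj p"] by simp
  qed (use spectrum_cnj_real[OF A_dims(1) Ah11_real] in blast)
  with neg show ?thesis
    unfolding poles by simp
qed

end
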